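(* Let $T$ be a tree of radius $h\ge0$, let $c\in(0,\frac12)$, let $t\ge1$ be an integer, and let $\Gamma$ and $G$ be graphs such that $G$ is a subgraph of $\Gamma$ and $\Gamma$ is $(c,t)$-sparse. Then either: \begin{itemize} \item $G$ has average degree less than $(4/c)^{4h|V(T)|}\,t$; or \item $G$ has a subgraph that is an induced subgraph of $\Gamma$ and is isomorphic to $T$. \end{itemize}
   Context: Graphs are finite and simple. Here $G$ is a (not necessarily induced) subgraph of $\Gamma$. The radius of a tree $T$ is the least $h\ge0$ such that some vertex $v\in V(T)$ has distance at most $h$ to every vertex of $T$. For $c>0$ and an integer $t\ge1$, a graph $\Gamma$ is $(c,t)$-sparse if for all (not necessarily disjoint) $A,B\subseteq V(\Gamma)$ with $|A|,|B|\ge t$, there are at most $(1-c)|A||B|$ ordered pairs $(u,v)$ with $u\in A$, $v\in B$, and $uv\in E(\Gamma)$. *)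

theory Defs
  imports Complex_Main "Graph_Theory.Graph_Theory"
begin

text \<open>
  A finite simple graph is a \<^locale>\<open>pair_graph\<close>: finite vertex set, loop-free symmetric arc relation,
  so that an edge \<open>uv\<close> is the pair of arcs \<open>(u, v)\<close>, \<open>(v, u)\<close>. Subgraphs, induced subgraphs,
  connectedness and isomorphism are those of the library.
\<close>

text \<open>
  The library's \<^const>\<open>tree\<close> must not be used here: in a symmetric digraph the closed walk
  \<open>u, v, u\<close> counts as a \<^const>\<open>pre_digraph.cycle\<close>, so no graph with an edge would be a
  tree. Closed walks with at least three arcs and no repeated vertex are exactly the cycles of the
  undirected simple graph. Trees are nonempty, since \<^const>\<open>connected\<close> excludes the null graph.
\<close>

definition graph_tree :: "'a pair_pre_digraph \<Rightarrow> bool" where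
  "graph_tree T \<longleftrightarrow> pair_graph T \<and> connected (with_proj T) \<and>
     \<not> (\<exists>p. pre_digraph.cycle (with_proj T) p \<and> 3 \<le> length p)"

text \<open>The distance is \<open>\<infinity>\<close> when no walk from \<open>u\<close> to \<open>v\<close> exists.\<close>

definition graph_dist :: "'a pair_pre_digraph \<Rightarrow> 'a \<Rightarrow> 'a \<Rightarrow> ereal" where
  "graph_dist G u v = wf_digraph.\<mu> (with_proj G) (\<lambda>_. 1) u v"

definition graph_radius :: "'a pair_pre_digraph \<Rightarrow> nat" where
  "graph_radius T = (LEAST h. \<exists>v\<in>pverts T. \<forall>u\<in>pverts T. graph_dist T v u \<le> ereal (real h))"

text \<open>
  In a symmetric digraph the out-degree is the degree of the underlying graph. The null graph gets
  average degree 0.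
\<close>

definition average_degree :: "'a pair_pre_digraph \<Rightarrow> real" where
  "average_degree G =
     (\<Sum>v\<in>pverts G. real (out_degree (with_proj G) v)) / real (card (pverts G))"

definition ct_sparse :: "real \<Rightarrow> nat \<Rightarrow> 'a pair_pre_digraph \<Rightarrow> bool" where
  "ct_sparse c t \<Gamma> \<longleftrightarrow>
     (\<forall>A B. A \<subseteq> pverts \<Gamma> \<and> B \<subseteq> pverts \<Gamma> \<and> t \<le> card A \<and> t \<le> card B \<longrightarrow>
        real (card {(u, v). u \<in> A \<and> v \<in> B \<and> (u, v) \<in> parcs \<Gamma>})
          \<le> (1 - c) * real (card A) * real (card B))"

end

theory Submission
  imports Defs
begin

text \<open>
  Call a vertex rich if it is the root of a blow-up tree of depth \<open>h\<close> in \<open>G\<close> with large branching in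
  which every path from the root is induced in \<open>\<Gamma>\<close>. Deleting from such a tree all vertices equal or
  adjacent in \<open>\<Gamma>\<close> to a given \<open>u\<close> leaves a tree with at least \<open>c/4\<close> times the branching,
  except for at most \<open>t (2/c)\<^sup>h\<close> exceptional \<open>u\<close>: this is sparsity, applied level by level. Hence only
  few arcs of \<open>G\<close> leave vertices that are not rich, and a rich vertex exists once the average degree
  is large. The tree \<open>T\<close> is then embedded greedily from its centre in order of distance: each new
  vertex is taken among the surviving children of its parent, avoiding the exceptional vertices for
  the blow-up trees hanging at all vertices embedded so far. This needs a branching of only about
  \<open>|T| t (2/c)\<^sup>h (4/c)\<^bsup>|T|\<^esup>\<close>, well within the required bound.
\<close>

section \<open>Rich vertices and the loss caused by deleting a closed neighbourhood\<close>

lemma card_pairs_le: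
  fixes b :: real
  assumes "finite S" "finite U" "\<And>z. z \<in> S \<Longrightarrow> real (card {u \<in> U. P u z}) \<le> b"
  shows "real (card {(u, z). u \<in> U \<and> z \<in> S \<and> P u z}) \<le> real (card S) * b"
proof -
  have "{(u, z). u \<in> U \<and> z \<in> S \<and> P u z} = prod.swap ` (SIGMA z:S. {u \<in> U. P u z})"
    by auto
  then have "card {(u, z). u \<in> U \<and> z \<in> S \<and> P u z} = card (SIGMA z:S. {u \<in> U. P u z})"
    by (simp add: card_image)
  also have "\<dots> = (\<Sum>z\<in>S. card {u \<in> U. P u z})"
    using assms by (simp add: card_SigmaI)
  finally have "real (card {(u, z). u \<in> U \<and> z \<in> S \<and> P u z}) = (\<Sum>z\<in>S. real (card {u \<in> U. P u z}))"
    by simp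
  also have "\<dots> \<le> (\<Sum>z\<in>S. b)" by (intro sum_mono assms)
  finally show ?thesis by simp
qed

text \<open>\<open>A\<close> is the arc set of the host \<Gamma> and \<open>E\<close> that of the
  subgraph G. The vertex set of G enters only later, as a set \<open>W\<close> that contains both
  ends of all arcs in \<open>E\<close>.\<close>

locale sparse_host =
  fixes V :: "'a set" and A E :: "('a \<times> 'a) set" and c :: real and t :: nat
  assumes finite_V: "finite V"
    and A_sub: "A \<subseteq> V \<times> V"
    and sym_A: "sym A"
    and irrefl_A: "irrefl A"
    and E_sub: "E \<subseteq> A"
    and sym_E: "sym E"
    and c_pos: "0 < c" and c_less: "c < 1/2"
    and t_pos: "1 \<le> t"
    and sparse: "\<And>X Y. X \<subseteq> V \<Longrightarrow> Y \<subseteq> V \<Longrightarrow> t \<le> card X \<Longrightarrow> t \<le> card Y \<Longrightarrow>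
      real (card (A \<inter> X \<times> Y)) \<le> (1 - c) * real (card X) * real (card Y)"
begin

text \<open>
  Vertices \<open>z\<close> below \<open>y\<close> must avoid the closed neighbourhood of \<open>X\<close>. In the recursive call \<open>y\<close> joins \<open>X\<close>,
  so that it is the grandchildren of \<open>y\<close>, not its children, that avoid \<open>y\<close>. The blow-up tree is not a
  separate object: it consists of all admissible descendants.
\<close>

primrec rich :: "real \<Rightarrow> 'a set \<Rightarrow> nat \<Rightarrow> 'a \<Rightarrow> bool" where
  "rich D X 0 y \<longleftrightarrow> True"
| "rich D X (Suc j) y \<longleftrightarrow>
    D \<le> real (card {z. (y, z) \<in> E \<and> z \<notin> X \<union> A `` X \<and> rich D (insert y X) j z})"

lemma arc_in_V: "(y, z) \<in> E \<Longrightarrow> y \<in> V" "(y, z) \<in> E \<Longrightarrow> z \<in> V"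
  using E_sub A_sub by auto

lemma finite_nbrs: "finite {z. (y, z) \<in> E \<and> P z}"
  by (rule finite_subset[OF _ finite_V]) (auto dest: arc_in_V)

lemma rich_mono:
  assumes "rich D X j y" "D' \<le> D" "X' \<subseteq> X"
  shows "rich D' X' j y"
  using assms
proof (induction j arbitrary: X X' y)
  case (Suc j)
  let ?S = "\<lambda>D X. {z. (y, z) \<in> E \<and> z \<notin> X \<union> A `` X \<and> rich D (insert y X) j z}"
  have "?S D X \<subseteq> ?S D' X'"
    using Suc.IH[OF _ Suc.prems(2), of "insert y X" _ "insert y X'"] Suc.prems(3) by blast
  then have "card (?S D X) \<le> card (?S D' X')"
    by (intro card_mono finite_nbrs)
  with Suc.prems show ?case by simp
qed simp

lemma two_div_c_gt_1: "1 < 2 / c"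
  using c_pos c_less by (simp add: field_simps)

lemma t_le_pow: "real t \<le> real t * (2/c) ^ j"
  using two_div_c_gt_1 by (simp add: mult_le_cancel_left1)

text \<open>Let \<open>S\<close> be the admissible children of \<open>y\<close> and \<open>U\<close>
  the bad vertices. Each pair in \<open>U \<times> S\<close> is adjacent in \<Gamma>, diagonal, bad
  one level lower, or a surviving child. Sparsity bounds the first kind by the fraction
  \<open>1 - c\<close>, badness of \<open>u\<close> the last by \<open>c/4\<close>, and the
  induction hypothesis the third; what remains costs one factor \<open>2/c\<close> per level. The
  assumption \<open>t \<le> D\<close> makes \<open>S\<close> large enough for sparsity, and
  \<open>4/c \<le> D\<close> makes the diagonal negligible.\<close>

lemma few_bad:
  assumes "rich D X j y" "real t \<le> D" "4 / c \<le> D"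
  shows "real (card {u \<in> V. \<not> rich (c/4 * D) (insert u X) j y}) \<le> real t * (2/c) ^ j"
  using assms(1)
proof (induction j arbitrary: X y)
  case (Suc j)
  define S where "S = {z. (y, z) \<in> E \<and> z \<notin> X \<union> A `` X \<and> rich D (insert y X) j z}"
  define U where "U = {u \<in> V. \<not> rich (c/4 * D) (insert u X) (Suc j) y}"
  define bad where "bad = (\<lambda>u z. \<not> rich (c/4 * D) (insert u (insert y X)) j z)"
  have S_V: "S \<subseteq> V" "finite S" and U_V: "U \<subseteq> V" "finite U"
    using finite_V by (auto simp: S_def U_def finite_nbrs dest: arc_in_V)
  have DS: "D \<le> card S" using Suc.prems by (simp add: S_def)
  show ?case
  proof (cases "t \<le> card U")
    case False
    then show ?thesis using t_le_pow[of "Suc j"] unfolding U_def by linarith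
  next
    case True
    have cS: "t \<le> card S" using DS assms(2) by linarith
    have S_pos: "0 < real (card S)" using cS t_pos by linarith
    define P1 where "P1 = A \<inter> U \<times> S"
    define P2 where "P2 = {(u, z). u \<in> U \<and> z \<in> S \<and> u = z}"
    define P3 where "P3 = {(u, z). u \<in> U \<and> z \<in> S \<and> bad u z}"
    \<comment> \<open>The coordinates are swapped because \<open>card_pairs_le\<close> bounds fibres
      over the second coordinate, and here the bound is per \<open>u\<close>.\<close>
    define P4 where "P4 = {(z, u). z \<in> S \<and> u \<in> U \<and> u \<noteq> z \<and> (u, z) \<notin> A \<and> \<not> bad u z}"
    have fin: "finite P1" "finite P2" "finite P3" "finite P4"
      using S_V U_V unfolding P1_def P2_def P3_def P4_def
      by (auto intro: finite_subset[of _ "U \<times> S"] finite_subset[of _ "S \<times> U"])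
    have "U \<times> S \<subseteq> P1 \<union> P2 \<union> P3 \<union> P4\<inverse>"
      unfolding P1_def P2_def P3_def P4_def by auto
    then have "card (U \<times> S) \<le> card (P1 \<union> P2 \<union> P3 \<union> P4\<inverse>)"
      using fin by (intro card_mono) auto
    also have "\<dots> \<le> card P1 + card P2 + card P3 + card (P4\<inverse>)"
      by (intro order.trans[OF card_Un_le] add_mono order.refl)
    also have "card (P4\<inverse>) = card P4" by simp
    finally have total: "real (card U) * real (card S)
        \<le> real (card P1) + real (card P2) + real (card P3) + real (card P4)"
      by (simp add: card_cartesian_product flip: of_nat_mult of_nat_add)
    have 1: "real (card P1) \<le> (1 - c) * real (card U) * real (card S)"
      unfolding P1_def using sparse S_V U_V True cS by blast
    have 2: "real (card P2) \<le> real (card U)"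
    proof -
      have "P2 \<subseteq> (\<lambda>u. (u, u)) ` U" unfolding P2_def by auto
      then show ?thesis using U_V surj_card_le by auto
    qed
    have 3: "real (card P3) \<le> real (card S) * (real t * (2/c) ^ j)"
      unfolding P3_def
    proof (rule card_pairs_le[OF S_V(2) U_V(2)])
      fix z assume "z \<in> S"
      then have "rich D (insert y X) j z" by (simp add: S_def)
      note Suc.IH[OF this]
      moreover have "card {u \<in> U. bad u z} \<le> card {u \<in> V. bad u z}"
        using U_V finite_V by (intro card_mono) auto
      ultimately show "real (card {u \<in> U. bad u z}) \<le> real t * (2/c) ^ j"
        unfolding bad_def by linarith
    qed
    have 4: "real (card P4) \<le> real (card U) * (c/4 * real (card S))"
      unfolding P4_def
    proof (rule card_pairs_le[OF U_V(2) S_V(2)])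
      fix u assume "u \<in> U"
      then have "\<not> rich (c/4 * D) (insert u X) (Suc j) y" by (simp add: U_def)
      moreover have "{z \<in> S. u \<noteq> z \<and> (u, z) \<notin> A \<and> \<not> bad u z} \<subseteq>
          {z. (y, z) \<in> E \<and> z \<notin> insert u X \<union> A `` insert u X
            \<and> rich (c/4 * D) (insert y (insert u X)) j z}"
        by (auto simp: S_def bad_def insert_commute)
      then have "card {z \<in> S. u \<noteq> z \<and> (u, z) \<notin> A \<and> \<not> bad u z} \<le>
          card {z. (y, z) \<in> E \<and> z \<notin> insert u X \<union> A `` insert u X
            \<and> rich (c/4 * D) (insert y (insert u X)) j z}"
        by (intro card_mono finite_nbrs)
      ultimately have "real (card {z \<in> S. u \<noteq> z \<and> (u, z) \<notin> A \<and> \<not> bad u z}) \<le> c/4 * D"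
        by simp
      also have "\<dots> \<le> c/4 * real (card S)" using DS c_pos by simp
      finally show "real (card {z \<in> S. u \<noteq> z \<and> (u, z) \<notin> A \<and> \<not> bad u z}) \<le> c/4 * real (card S)" .
    qed
    have "1 \<le> c/4 * real (card S)"
    proof -
      have "c/4 * (4/c) \<le> c/4 * real (card S)"
        using DS assms(3) c_pos by (intro mult_left_mono) auto
      then show ?thesis using c_pos by simp
    qed
    then have 5: "real (card U) * 1 \<le> real (card U) * (c/4 * real (card S))"
      by (intro mult_left_mono) auto
    \<comment> \<open>The fraction left for \<open>P3\<close> is 1 - (1 - c) - c/4 - c/4 = c/2, the
      two quarters paying for \<open>P2\<close> and \<open>P4\<close>.\<close>
    have "real (card S) * (c/2 * real (card U)) \<le> real (card S) * (real t * (2/c) ^ j)"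
    proof -
      have "s * (c/2 * u) = u * s - (1 - c) * u * s - u * (c/4 * s) - u * (c/4 * s)" for u s :: real
        by (simp add: field_simps)
      from this[of "real (card S)" "real (card U)"] total 1 2 3 4 5 show ?thesis by linarith
    qed
    then have "c/2 * real (card U) \<le> real t * (2/c) ^ j"
      using S_pos by simp
    then have "real (card U) \<le> real t * (2/c) ^ Suc j"
      using c_pos by (simp add: field_simps)
    then show ?thesis by (simp add: U_def)
  qed
qed simp

section \<open>Existence of a rich vertex in a dense graph\<close>

text \<open>
  The induction counts arcs rather than vertices: by symmetry as many arcs enter the set of poor
  vertices as leave it, so poor vertices of large degree do no harm.
\<close>

lemma arcs_from_poor_le:
  assumes "finite W" "E \<subseteq> W \<times> W" "W \<subseteq> V"
    and "\<And>i. i < j \<Longrightarrow> real t \<le> (c/4) ^ i * D" "\<And>i. i < j \<Longrightarrow> 4 / c \<le> (c/4) ^ i * D"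
    and "0 \<le> D"
  shows "real (card {(y, z). (y, z) \<in> E \<and> \<not> rich ((c/4) ^ j * D) {} j y})
    \<le> real (card W) * (real t * (2/c) ^ j + (D - (c/4) ^ j * D))"
  using assms(4,5)
proof (induction j)
  case (Suc j)
  define R where "R = (\<lambda>j y. rich ((c/4) ^ j * D) {} j y)"
  define bad where "bad = (\<lambda>y z. \<not> rich ((c/4) ^ Suc j * D) {y} j z)"
  \<comment> \<open>An arc from \<open>y\<close>, poor at \<open>Suc j\<close>, to \<open>z\<close>
    is of one of three kinds: \<open>z\<close> is poor at \<open>j\<close>, and the reversed arc
    lies in \<open>Q1\<close>; \<open>z\<close> is rich but loses this when \<open>y\<close> is
    excluded (\<open>Q2\<close>, bounded by \<open>few_bad\<close>); or \<open>z\<close> stays rich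
    (\<open>Q3\<close>, few for each \<open>y\<close> because \<open>y\<close> is poor).\<close>
  define Q1 where "Q1 = {(y, z). (y, z) \<in> E \<and> \<not> R j y}"
  define Q2 where "Q2 = {(y, z). y \<in> W \<and> z \<in> W \<and> (R j z \<and> bad y z)}"
  define Q3 where "Q3 = {(z, y). z \<in> W \<and> y \<in> W \<and> ((y, z) \<in> E \<and> \<not> R (Suc j) y \<and> \<not> bad y z)}"
  have finE: "finite E" using assms(1,2) finite_subset by blast
  have fin: "finite Q1" "finite Q2" "finite Q3"
    using assms(1) finE unfolding Q1_def Q2_def Q3_def
    by (auto intro: finite_subset[of _ "W \<times> W"] finite_subset[of _ E])
  have "{(y, z). (y, z) \<in> E \<and> \<not> R (Suc j) y} \<subseteq> Q1\<inverse> \<union> Q2 \<union> Q3\<inverse>"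
  proof (intro subrelI)
    fix y z assume "(y, z) \<in> {(y, z). (y, z) \<in> E \<and> \<not> R (Suc j) y}"
    then show "(y, z) \<in> Q1\<inverse> \<union> Q2 \<union> Q3\<inverse>"
      using assms(2) symD[OF sym_E, of y z] unfolding Q1_def Q2_def Q3_def by blast
  qed
  then have "card {(y, z). (y, z) \<in> E \<and> \<not> R (Suc j) y}
      \<le> card (Q1\<inverse> \<union> Q2 \<union> Q3\<inverse>)"
    using fin by (intro card_mono) auto
  also have "\<dots> \<le> card (Q1\<inverse>) + card Q2 + card (Q3\<inverse>)"
    by (intro order.trans[OF card_Un_le] add_mono order.refl)
  also have "\<dots> = card Q1 + card Q2 + card Q3" by simp
  finally have total: "real (card {(y, z). (y, z) \<in> E \<and> \<not> R (Suc j) y})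
      \<le> real (card Q1) + real (card Q2) + real (card Q3)"
    by linarith
  have 1: "real (card Q1) \<le> real (card W) * (real t * (2/c) ^ j + (D - (c/4) ^ j * D))"
    using Suc unfolding Q1_def R_def by simp
  have 2: "real (card Q2) \<le> real (card W) * (real t * (2/c) ^ j)"
    unfolding Q2_def
  proof (rule card_pairs_le[OF assms(1) assms(1)])
    fix z assume "z \<in> W"
    show "real (card {y \<in> W. R j z \<and> bad y z}) \<le> real t * (2/c) ^ j"
    proof (cases "R j z")
      case True
      then have "real (card {y \<in> V. bad y z}) \<le> real t * (2/c) ^ j"
        using few_bad[of "(c/4) ^ j * D" "{}" j z] Suc.prems
        unfolding R_def bad_def by (simp add: mult.assoc)
      moreover have "card {y \<in> W. R j z \<and> bad y z} \<le> card {y \<in> V. bad y z}"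
        using assms(3) finite_V by (intro card_mono) auto
      ultimately show ?thesis by linarith
    next
      case False
      then show ?thesis using c_pos by simp
    qed
  qed
  have 3: "real (card Q3) \<le> real (card W) * ((c/4) ^ Suc j * D)"
    unfolding Q3_def
  proof (rule card_pairs_le[OF assms(1) assms(1)])
    fix y assume "y \<in> W"
    have *: "{z \<in> W. (y, z) \<in> E \<and> \<not> R (Suc j) y \<and> \<not> bad y z} \<subseteq>
      {z. (y, z) \<in> E \<and> rich ((c/4) ^ Suc j * D) {y} j z}"
      by (auto simp: bad_def)
    show "real (card {z \<in> W. (y, z) \<in> E \<and> \<not> R (Suc j) y \<and> \<not> bad y z}) \<le> (c/4) ^ Suc j * D"
    proof (cases "R (Suc j) y")
      case True
      then show ?thesis using c_pos assms(6) by simp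
    next
      case False
      then have "card {z. (y, z) \<in> E \<and> rich ((c/4) ^ Suc j * D) {y} j z} \<le> (c/4) ^ Suc j * D"
        unfolding R_def by simp
      moreover note card_mono[OF finite_nbrs *]
      ultimately show ?thesis by linarith
    qed
  qed
  \<comment> \<open>The term \<open>D - (c/4) ^ j * D\<close> dominates the sum of
    \<open>(c/4) ^ i * D\<close> over 1 \<le> i \<le> j. Passing to \<open>Suc j\<close> needs only
    2 * (c/4) \<le> 1 for this term and 2 \<le> 2/c for the power of \<open>2/c\<close>.\<close>
  have 4: "2 * (c/4 * ((c/4) ^ j * D)) \<le> (c/4) ^ j * D"
  proof -
    have "(c/2) * ((c/4) ^ j * D) \<le> 1 * ((c/4) ^ j * D)"
      using c_pos c_less assms(6) by (intro mult_right_mono) auto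
    then show ?thesis by linarith
  qed
  have "2 * (real t * (2/c) ^ j) \<le> (2/c) * (real t * (2/c) ^ j)"
    using c_pos c_less by (intro mult_right_mono) (auto simp: field_simps)
  then have 5: "2 * (real t * (2/c) ^ j) \<le> real t * (2/c) ^ Suc j"
    by (simp add: mult_ac)
  have distrib: "w * x + w * y + w * z = w * (x + y + z)" for w x y z :: real
    by (simp add: distrib_left)
  have "real (card {(y, z). (y, z) \<in> E \<and> \<not> R (Suc j) y}) \<le>
      real (card W) * (real t * (2/c) ^ j + (D - (c/4) ^ j * D))
      + real (card W) * (real t * (2/c) ^ j) + real (card W) * ((c/4) ^ Suc j * D)"
    by (rule order.trans[OF total]) (intro add_mono 1 2 3)
  also have "\<dots> = real (card W) *
      ((real t * (2/c) ^ j + (D - (c/4) ^ j * D)) + real t * (2/c) ^ j + (c/4) ^ Suc j * D)"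
    by (rule distrib)
  also have "\<dots> \<le> real (card W) * (real t * (2/c) ^ Suc j + (D - (c/4) ^ Suc j * D))"
  proof (rule mult_left_mono)
    have *: "x + (D - y) + x + z \<le> x' + (D - z)" if "2 * z \<le> y" "2 * x \<le> x'" for x x' y z :: real
      using that by linarith
    show "(real t * (2/c) ^ j + (D - (c/4) ^ j * D)) + real t * (2/c) ^ j + (c/4) ^ Suc j * D
      \<le> real t * (2/c) ^ Suc j + (D - (c/4) ^ Suc j * D)"
      by (rule *[OF _ 5]) (use 4 in \<open>simp only: power_Suc mult.assoc\<close>)
  qed simp
  finally show ?case unfolding R_def .
qed simp

text \<open>If all vertices of \<open>W\<close> were poor, every arc would leave a poor vertex, but
  the bound on such arcs falls short of the assumed density by \<open>(c/4) ^ h * D\<close> per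
  vertex. Lower bounds at exponent \<open>h\<close> suffice, since \<open>(c/4) ^ i * D\<close>
  decreases in \<open>i\<close>.\<close>

lemma exists_rich:
  assumes "finite W" "W \<noteq> {}" "E \<subseteq> W \<times> W" "W \<subseteq> V"
    and "real t \<le> (c/4) ^ h * D" "4 / c \<le> (c/4) ^ h * D"
    and dense: "real (card W) * (real t * (2/c) ^ h + D) \<le> real (card E)"
  shows "\<exists>w\<in>W. rich ((c/4) ^ h * D) {} h w"
proof (rule ccontr)
  assume none: "\<not> ?thesis"
  have "0 < (c/4) ^ h * D" using assms(5) t_pos by linarith
  then have D: "0 < D" using c_pos by (simp add: zero_less_mult_iff)
  have decr: "(c/4) ^ h * D \<le> (c/4) ^ i * D" if "i < h" for i
    using that c_pos c_less D by (intro mult_right_mono power_decreasing) auto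
  have all_poor: "{(y, z). (y, z) \<in> E \<and> \<not> rich ((c/4) ^ h * D) {} h y} = E"
    using none assms(3) by auto
  have "real (card {(y, z). (y, z) \<in> E \<and> \<not> rich ((c/4) ^ h * D) {} h y})
      \<le> real (card W) * (real t * (2/c) ^ h + (D - (c/4) ^ h * D))"
    by (intro arcs_from_poor_le[OF assms(1,3,4)] order.trans[OF assms(5) decr]
      order.trans[OF assms(6) decr] less_imp_le[OF D])
  also have "\<dots>
      < real (card W) * (real t * (2/c) ^ h + D)"
  proof (rule mult_strict_left_mono)
    show "real t * (2/c) ^ h + (D - (c/4) ^ h * D) < real t * (2/c) ^ h + D"
      using \<open>0 < (c/4) ^ h * D\<close> by linarith
    show "0 < real (card W)" using assms(1,2) by (simp add: card_gt_0_iff)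
  qed
  finally show False unfolding all_poor using dense by (meson not_less)
qed

end

section \<open>Growing a tree vertex by vertex in order of distance from the root\<close>

lemma (in pair_graph) parcs_sym: "(u, v) \<in> parcs G \<Longrightarrow> (v, u) \<in> parcs G"
  using pair_sym_arcs unfolding symmetric_conv by auto

text \<open>The distance from \<open>r\<close> as a natural number; it is meaningful only when
  \<open>v\<close> is reachable from \<open>r\<close>.\<close>

definition level :: "'b pair_pre_digraph \<Rightarrow> 'b \<Rightarrow> 'b \<Rightarrow> nat" where
  "level T r v = (LEAST n. (r, v) \<in> parcs T ^^ n)"

lemma (in pair_graph) awalk_imp_relpow:
  "awalk u p v \<Longrightarrow> (u, v) \<in> parcs G ^^ length p"
proof (induction p arbitrary: u)
  case (Cons e p)
  then show ?case
    by (cases e) (auto simp: awalk_Cons_iff simp del: relpow.simps intro: relpow_Suc_I2)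
qed (auto simp: awalk_Nil_iff)

lemma (in pair_graph) reachable_in_imp_awalk:
  assumes "(x, y) \<in> (parcs G \<inter> S \<times> S)\<^sup>*" "x \<in> pverts G"
  shows "\<exists>p. awalk x p y \<and> set p \<subseteq> S \<times> S"
  using assms(1)
proof (induction rule: rtrancl_induct)
  case base
  show ?case using assms(2) by (intro exI[of _ "[]"]) (simp add: awalk_Nil_iff)
next
  case (step y z)
  then obtain p where "awalk x p y" "set p \<subseteq> S \<times> S" by auto
  then have "awalk x (p @ [(y, z)]) z" "set (p @ [(y, z)]) \<subseteq> S \<times> S"
    using step.hyps by (auto simp: awalk_simps dest: in_arcsD2)
  then show ?case by blast
qed

text \<open>The second assumption on \<open>S\<close> says that \<open>S\<close> induces a connected
  subgraph. Two neighbours of \<open>b\<close> in \<open>S\<close> would be joined by a path inside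
  \<open>S\<close>, and \<open>b\<close> would close it to a cycle.\<close>

lemma tree_unique_neighbour:
  assumes T: "graph_tree T" and S: "S \<subseteq> pverts T" "S \<times> S \<subseteq> (parcs T \<inter> S \<times> S)\<^sup>*"
    and b: "b \<notin> S" and x: "x \<in> S" "(x, b) \<in> parcs T" and y: "y \<in> S" "(y, b) \<in> parcs T"
  shows "x = y"
proof (rule ccontr)
  assume "x \<noteq> y"
  interpret T: pair_graph T using T by (simp add: graph_tree_def)
  obtain p where p: "T.awalk x p y" "set p \<subseteq> S \<times> S"
    using T.reachable_in_imp_awalk[of x y S] S x y by auto
  define q where "q = T.awalk_to_apath p"
  have q: "T.apath x q y" "set q \<subseteq> S \<times> S"
    using p T.apath_awalk_to_apath T.awalk_to_apath_subset unfolding q_def by blast+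
  have qw: "T.awalk x q y" and qd: "distinct (pawalk_verts x q)" using q by (auto simp: T.apath_def)
  have "q \<noteq> []" using \<open>x \<noteq> y\<close> qw by (auto simp: T.awalk_Nil_iff)
  let ?c = "q @ [(y, b), (b, x)]"
  have c: "T.awalk x ?c x"
    using qw y x T.parcs_sym by (auto simp: T.awalk_simps dest: T.in_arcsD1)
  have heads: "pawalk_verts u p = u # map snd p" if "T.awalk u p v" for u p v
    using that T.awalk_verts_conv'[of u p v] by (cases p) (auto simp: T.awalk_def)
  \<comment> \<open>In the vertex list of a cycle only the start is repeated, so after dropping it
    every vertex must be new: \<open>b\<close> lies outside \<open>S\<close>, and the path
    \<open>q\<close> never returns to \<open>x\<close>.\<close>
  have "b \<notin> snd ` set q" "x \<notin> snd ` set q"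
    using q b qd heads[OF qw] by auto
  then have "distinct (tl (pawalk_verts x ?c))"
    using qd heads[OF qw] heads[OF c] b x by auto
  then have "T.cycle ?c" unfolding T.cycle_def using c by blast
  \<comment> \<open>A nonempty \<open>q\<close> rules out the closed walk \<open>x, b, x\<close>,
    which \<open>graph_tree\<close> permits.\<close>
  moreover have "3 \<le> length ?c" using \<open>q \<noteq> []\<close> by (cases q) auto
  ultimately show False using T unfolding graph_tree_def by blast
qed

text \<open>Take \<open>b\<close> outside \<open>S\<close> of least level. Its predecessor on a
  shortest walk from \<open>r\<close> has smaller level and hence lies in \<open>S\<close>;
  acyclicity makes it the only neighbour of \<open>b\<close> there.\<close>

lemma tree_grow:
  assumes T: "graph_tree T" and r: "r \<in> S" and S: "S \<subset> pverts T"
    "S \<times> S \<subseteq> (parcs T \<inter> S \<times> S)\<^sup>*"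
    and reach: "\<And>v. v \<in> pverts T \<Longrightarrow> \<exists>n. (r, v) \<in> parcs T ^^ n"
  shows "\<exists>a b. a \<in> S \<and> b \<in> pverts T - S \<and> (a, b) \<in> parcs T \<and>
    level T r b = Suc (level T r a) \<and> (\<forall>x\<in>S. (x, b) \<in> parcs T \<longrightarrow> x = a) \<and>
    insert b S \<times> insert b S \<subseteq> (parcs T \<inter> insert b S \<times> insert b S)\<^sup>*"
proof -
  interpret T: pair_graph T using T by (simp add: graph_tree_def)
  have lev: "(r, v) \<in> parcs T ^^ level T r v" if "v \<in> pverts T" for v
    unfolding level_def using reach[OF that] by (rule LeastI_ex)
  have lev_le: "level T r v \<le> n" if "(r, v) \<in> parcs T ^^ n" for v n
    unfolding level_def using that by (rule Least_le)
  obtain b where b: "b \<in> pverts T - S" and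
    min: "\<And>v. v \<in> pverts T - S \<Longrightarrow> level T r b \<le> level T r v"
    using S ex_has_least_nat[of "\<lambda>v. v \<in> pverts T - S" _ "level T r"] by blast
  have "level T r b \<noteq> 0" using lev[of b] b r by (metis DiffD1 DiffD2 relpow_0_E)
  then obtain l where l: "level T r b = Suc l" using not0_implies_Suc by blast
  then obtain a where a: "(r, a) \<in> parcs T ^^ l" "(a, b) \<in> parcs T"
    using lev[of b] b by auto
  have "level T r a \<le> l" using lev_le a by blast
  moreover have aT: "a \<in> pverts T" using a T.in_arcsD1 by blast
  moreover have "level T r b \<le> Suc (level T r a)"
    using lev[OF aT] a(2) by (intro lev_le) auto
  ultimately have la: "level T r b = Suc (level T r a)" using l by simp
  have aS: "a \<in> S" using min[of a] aT la by auto
  have uniq: "x = a" if "x \<in> S" "(x, b) \<in> parcs T" for x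
    using tree_unique_neighbour[OF T _ S(2), of b x a] that a b aS S(1) by auto
  let ?R = "(parcs T \<inter> insert b S \<times> insert b S)\<^sup>*"
  have R: "(x, y) \<in> ?R" if "x \<in> S" "y \<in> S" for x y
    using that S(2) rtrancl_mono[of "parcs T \<inter> S \<times> S" "parcs T \<inter> insert b S \<times> insert b S"] by auto
  have "(a, b) \<in> ?R" "(b, a) \<in> ?R" using a(2) T.parcs_sym aS by auto
  then have "insert b S \<times> insert b S \<subseteq> ?R"
    using R aS by (auto intro: rtrancl_trans)
  with aS b a(2) la uniq show ?thesis by blast
qed

section \<open>Greedy embedding of the tree\<close>

context sparse_host
begin

text \<open>The invariant of the greedy embedding. As \<open>E \<subseteq> A\<close>, the two
  implications make the image a copy in G that is induced in \<Gamma>. The last clause keeps below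
  each \<open>f v\<close> a blow-up tree of the depth still required, away from the closed
  neighbourhoods of all other images.\<close>

definition rich_embedding :: "'b pair_pre_digraph \<Rightarrow> 'b \<Rightarrow> nat \<Rightarrow> 'a set \<Rightarrow> real \<Rightarrow> 'b set \<Rightarrow> ('b \<Rightarrow> 'a) \<Rightarrow> bool" where
  "rich_embedding T r h W D S f \<longleftrightarrow> inj_on f S \<and> f ` S \<subseteq> W \<and>
    (\<forall>x\<in>S. \<forall>y\<in>S. ((x, y) \<in> parcs T \<longrightarrow> (f x, f y) \<in> E) \<and> ((f x, f y) \<in> A \<longrightarrow> (x, y) \<in> parcs T)) \<and>
    (\<forall>v\<in>S. rich D (f ` S - {f v}) (h - level T r v) (f v))"

text \<open>By \<open>few_bad\<close>, each embedded vertex rules out at most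
  \<open>t * (2/c) ^ h\<close> choices for the new image, while \<open>f a\<close> offers at least
  \<open>D\<close> children. The price is one factor \<open>c/4\<close> in the branching.\<close>

lemma rich_embedding_extend:
  assumes emb: "rich_embedding T r h W D S f" and T: "pair_graph T"
    and S: "S \<subseteq> pverts T" and W: "E \<subseteq> W \<times> W"
    and a: "a \<in> S" and b: "b \<notin> S" and ab: "(a, b) \<in> parcs T"
    and lev: "level T r b = Suc (level T r a)" "level T r b \<le> h"
    and uniq: "\<And>x. x \<in> S \<Longrightarrow> (x, b) \<in> parcs T \<Longrightarrow> x = a"
    and D: "real (card S) * (real t * (2/c) ^ h) < D" "4 / c \<le> D"
  shows "\<exists>z. rich_embedding T r h W (c/4 * D) (insert b S) (f(b := z))"
proof -
  interpret T: pair_graph T by (rule T)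
  have finS: "finite S" using S T.pair_finite_verts finite_subset by blast
  define X where "X = f ` S - {f a}"
  have insX: "insert (f a) X = f ` S" using a by (auto simp: X_def)
  define N where "N = {z. (f a, z) \<in> E \<and> z \<notin> X \<union> A `` X \<and> rich D (f ` S) (h - level T r b) z}"
  have "h - level T r a = Suc (h - level T r b)" using lev by simp
  moreover have "rich D X (h - level T r a) (f a)"
    using emb a by (simp add: rich_embedding_def X_def)
  ultimately have "rich D X (Suc (h - level T r b)) (f a)" by (simp only:)
  then have DN: "D \<le> real (card N)" by (simp add: N_def insX)
  define bad where "bad v = {u \<in> V. \<not> rich (c/4 * D) (insert u (f ` S - {f v})) (h - level T r v) (f v)}" for v
  have "1 \<le> card S" using finS a by (metis One_nat_def Suc_leI card_gt_0_iff empty_iff)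
  then have "1 * (real t * (2/c) ^ h) \<le> real (card S) * (real t * (2/c) ^ h)"
    using c_pos by (intro mult_right_mono) auto
  then have tD: "real t \<le> D" using D t_le_pow[of h] by linarith
  have bad: "real (card (bad v)) \<le> real t * (2/c) ^ h" if "v \<in> S" for v
  proof -
    have "real (card (bad v)) \<le> real t * (2/c) ^ (h - level T r v)"
      unfolding bad_def using emb that tD D(2) by (intro few_bad) (auto simp: rich_embedding_def)
    also have "\<dots> \<le> real t * (2/c) ^ h"
      using two_div_c_gt_1 by (intro mult_left_mono power_increasing) auto
    finally show ?thesis .
  qed
  have "real (card (\<Union>v\<in>S. bad v)) \<le> real (\<Sum>v\<in>S. card (bad v))"
    using card_UN_le[OF finS] by (simp only: of_nat_le_iff)
  also have "\<dots> \<le> (\<Sum>v\<in>S. real t * (2/c) ^ h)"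
    unfolding of_nat_sum by (intro sum_mono bad)
  also have "\<dots> < real (card N)" using D(1) DN by simp
  finally have "card (\<Union>v\<in>S. bad v) < card N" by simp
  moreover have "finite (\<Union>v\<in>S. bad v)" using finS finite_V by (auto simp: bad_def)
  ultimately have "\<not> N \<subseteq> (\<Union>v\<in>S. bad v)" using card_mono not_less by blast
  then obtain z where z: "z \<in> N" "\<And>v. v \<in> S \<Longrightarrow> z \<notin> bad v" by auto
  have az: "(f a, z) \<in> E" and zX: "z \<notin> X" "z \<notin> A `` X" and zrich: "rich D (f ` S) (h - level T r b) z"
    using z(1) by (auto simp: N_def)
  have "(f a, z) \<in> A" using az E_sub by auto
  then have "z \<noteq> f a" using irrefl_A by (auto simp: irrefl_def)
  then have zS: "z \<notin> f ` S" using zX(1) by (auto simp: X_def)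
  have zV: "z \<in> V" "z \<in> W" using az W arc_in_V by auto
  have "inj_on f S" using emb by (simp add: rich_embedding_def)
  \<comment> \<open>As \<open>z\<close> has no \<Gamma>-neighbour in \<open>X\<close>, its only
    neighbour among the images is \<open>f a\<close>.\<close>
  then have non: "y = a" if "y \<in> S" "(f y, z) \<in> A" for y
    using that zX(2) a by (auto simp: X_def dest: inj_onD)
  have za: "(z, f a) \<in> E" using az sym_E by (auto dest: symD)
  have symA: "(u, v) \<in> A \<Longrightarrow> (v, u) \<in> A" for u v using sym_A by (auto dest: symD)
  let ?f = "f(b := z)"
  have f: "?f x = f x" if "x \<in> S" for x using that b by auto
  have img: "?f ` insert b S = insert z (f ` S)" using b by auto
  have "inj_on ?f (insert b S)"
    using \<open>inj_on f S\<close> zS b by (auto simp: inj_on_def)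
  moreover have "?f ` insert b S \<subseteq> W" using emb zV unfolding img by (simp add: rich_embedding_def)
  moreover have "((x, y) \<in> parcs T \<longrightarrow> (?f x, ?f y) \<in> E) \<and> ((?f x, ?f y) \<in> A \<longrightarrow> (x, y) \<in> parcs T)"
    if xy: "x \<in> insert b S" "y \<in> insert b S" for x y
  proof -
    have ba: "(b, a) \<in> parcs T" using ab T.parcs_sym by blast
    consider "x \<in> S" "y \<in> S" | "x = b" "y \<in> S" | "x \<in> S" "y = b" | "x = b" "y = b"
      using xy by blast
    then show ?thesis
    proof cases
      case 1
      then show ?thesis using emb b by (auto simp: rich_embedding_def)
    next
      case 2
      then show ?thesis using uniq[of y] non[of y] T.parcs_sym symA za ba b by auto
    next
      case 3
      then show ?thesis using uniq[of x] non[of x] az ab b by auto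
    next
      case 4
      then show ?thesis using T.pair_no_loops[of "(b, b)"] irrefl_A by (auto simp: irrefl_def)
    qed
  qed
  moreover have "rich (c/4 * D) (?f ` insert b S - {?f v}) (h - level T r v) (?f v)"
    if v: "v \<in> insert b S" for v
  proof (cases "v = b")
    case True
    have "c/4 * D \<le> 1 * D" using c_less tD by (intro mult_right_mono) auto
    moreover have "insert z (f ` S) - {z} \<subseteq> f ` S" by auto
    ultimately show ?thesis using rich_mono[OF zrich] True unfolding img by simp
  next
    case False
    then have "v \<in> S" using v by auto
    then have "rich (c/4 * D) (insert z (f ` S - {f v})) (h - level T r v) (f v)"
      using z(2)[of v] zV by (simp add: bad_def)
    moreover have "insert z (f ` S) - {f v} = insert z (f ` S - {f v})"
      using zS \<open>v \<in> S\<close> by auto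
    ultimately show ?thesis using False unfolding img by simp
  qed
  ultimately show ?thesis unfolding rich_embedding_def by blast
qed

text \<open>Starting from \<open>r\<close> sent to \<open>w\<close>, each extension multiplies the
  branching by \<open>c/4\<close>; the assumptions on \<open>D\<close> are what the extension from
  \<open>Suc k\<close> embedded vertices needs.\<close>

lemma tree_embeds:
  assumes T: "graph_tree T" and r: "r \<in> pverts T"
    and reach: "\<And>v. v \<in> pverts T \<Longrightarrow> \<exists>n\<le>h. (r, v) \<in> parcs T ^^ n"
    and W: "E \<subseteq> W \<times> W" and w: "w \<in> W" "rich D {} h w"
    and D: "\<And>k. Suc k < card (pverts T) \<Longrightarrow> real (Suc k) * (real t * (2/c) ^ h) < (c/4) ^ k * D"
      "\<And>k. Suc k < card (pverts T) \<Longrightarrow> 4 / c \<le> (c/4) ^ k * D"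
  shows "\<exists>f. inj_on f (pverts T) \<and> f ` pverts T \<subseteq> W \<and>
    (\<forall>x\<in>pverts T. \<forall>y\<in>pverts T. ((x, y) \<in> parcs T \<longrightarrow> (f x, f y) \<in> E) \<and>
      ((f x, f y) \<in> A \<longrightarrow> (x, y) \<in> parcs T))"
proof -
  interpret T: pair_graph T using T by (simp add: graph_tree_def)
  note fin = T.pair_finite_verts
  have reach': "\<exists>n. (r, v) \<in> parcs T ^^ n" if "v \<in> pverts T" for v
    using reach[OF that] by blast
  have lev: "level T r v \<le> h" if "v \<in> pverts T" for v
    using reach[OF that] Least_le unfolding level_def by (meson le_trans)
  have steps: "\<exists>S f. S \<subseteq> pverts T \<and> card S = Suc k \<and> r \<in> S \<and> S \<times> S \<subseteq> (parcs T \<inter> S \<times> S)\<^sup>* \<and>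
      rich_embedding T r h W ((c/4) ^ k * D) S f" if "k < card (pverts T)" for k
    using that
  proof (induction k)
    case 0
    have "level T r r = 0" unfolding level_def by (rule Least_eq_0) simp
    then have "rich_embedding T r h W D {r} (\<lambda>_. w)"
      using w T.pair_no_loops[of "(r, r)"] irrefl_A by (auto simp: rich_embedding_def irrefl_def)
    then show ?case using r by (intro exI[of _ "{r}"] exI[of _ "\<lambda>_. w"]) auto
  next
    case (Suc k)
    then obtain S f where S: "S \<subseteq> pverts T" "card S = Suc k" "r \<in> S"
      "S \<times> S \<subseteq> (parcs T \<inter> S \<times> S)\<^sup>*" and emb: "rich_embedding T r h W ((c/4) ^ k * D) S f"
      by auto
    have sub: "S \<subset> pverts T" using S Suc.prems by auto
    obtain a b where ab: "a \<in> S" "b \<in> pverts T - S" "(a, b) \<in> parcs T"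
      "level T r b = Suc (level T r a)" "\<forall>x\<in>S. (x, b) \<in> parcs T \<longrightarrow> x = a"
      "insert b S \<times> insert b S \<subseteq> (parcs T \<inter> insert b S \<times> insert b S)\<^sup>*"
      using tree_grow[OF T S(3) sub S(4) reach'] by blast
    have b: "b \<notin> S" "b \<in> pverts T" using ab(2) by auto
    have "\<exists>z. rich_embedding T r h W (c/4 * ((c/4) ^ k * D)) (insert b S) (f(b := z))"
      by (rule rich_embedding_extend[OF emb T.pair_graph S(1) W ab(1) b(1) ab(3,4) lev[OF b(2)]])
        (use ab(5) D[OF Suc.prems] S(2) in auto)
    then obtain z where "rich_embedding T r h W (c/4 * ((c/4) ^ k * D)) (insert b S) (f(b := z))"
      by blast
    then have "rich_embedding T r h W ((c/4) ^ Suc k * D) (insert b S) (f(b := z))"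
      by (simp only: power_Suc mult.assoc)
    moreover have "card (insert b S) = Suc (Suc k)"
      using S ab(2) fin by (simp add: finite_subset)
    moreover have "insert b S \<subseteq> pverts T" "r \<in> insert b S" using S ab(2) by auto
    ultimately show ?case using ab(6) by blast
  qed
  have "0 < card (pverts T)" using r fin by (auto simp: card_gt_0_iff)
  then obtain k where k: "card (pverts T) = Suc k" by (auto simp: gr0_conv_Suc)
  then obtain S f where S: "S \<subseteq> pverts T" "card S = card (pverts T)"
      and emb: "rich_embedding T r h W ((c/4) ^ k * D) S f"
    using steps[of k] by (metis lessI)
  have "S = pverts T" using S fin card_subset_eq by blast
  with emb show ?thesis unfolding rich_embedding_def by blast
qed

end

section \<open>Distances, average degree and the centre of a tree\<close>

context pair_graph
begin

lemma graph_dist_le_imp_relpow: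
  assumes "graph_dist G r v \<le> ereal (real h)"
  shows "\<exists>n\<le>h. (r, v) \<in> parcs G ^^ n"
proof -
  \<comment> \<open>The distance is an infimum, so a strict bound is used to obtain an actual walk;
    since its length is an integer, it is at most \<open>h\<close>.\<close>
  have "graph_dist G r v < ereal (real (Suc h))"
    using assms by (rule order.strict_trans1) simp
  then obtain p where p: "awalk r p v" "awalk_cost (\<lambda>_. 1) p < real (Suc h)"
    unfolding graph_dist_def \<mu>_def INF_less_iff by auto
  have "awalk_cost (\<lambda>_. 1) p = real (length p)"
    by (induction p) auto
  with p have "length p \<le> h" by simp
  with awalk_imp_relpow[OF p(1)] show ?thesis by blast
qed

lemma graph_dist_le_length:
  assumes "awalk r p v"
  shows "graph_dist G r v \<le> ereal (real (length p))"
proof -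
  have "awalk_cost (\<lambda>_. 1) p = real (length p)"
    by (induction p) auto
  with min_cost_le_walk_cost[OF assms, of "\<lambda>_. 1"] show ?thesis
    by (simp add: graph_dist_def)
qed

lemma average_degree_conv: "average_degree G = real (card (parcs G)) / real (card (pverts G))"
proof -
  have "card (parcs G) = card (\<Union>v\<in>pverts G. out_arcs (with_proj G) v)"
    by (rule arg_cong[of _ _ card]) (auto simp: out_arcs_def dest: in_arcsD1)
  also have "\<dots> = (\<Sum>v\<in>pverts G. out_degree (with_proj G) v)"
    unfolding out_degree_def
    by (rule card_UN_disjoint) (auto simp: out_arcs_def pair_finite_verts pair_finite_arcs)
  finally show ?thesis by (simp add: average_degree_def)
qed

end

text \<open>The least value in \<open>graph_radius\<close> is attained once some bound exists, and
  paths from any root have at most \<open>card (pverts T)\<close> arcs.\<close>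

lemma tree_centre:
  assumes "graph_tree T"
  shows "\<exists>r\<in>pverts T. \<forall>v\<in>pverts T. graph_dist T r v \<le> ereal (real (graph_radius T))"
  unfolding graph_radius_def
proof (rule LeastI_ex)
  interpret pair_graph T using assms by (simp add: graph_tree_def)
  have "strongly_connected (with_proj T)"
    using assms pair_sym_arcs symmetric_connected_imp_strongly_connected by (simp add: graph_tree_def)
  then obtain r where r: "r \<in> pverts T" and "\<And>v. v \<in> pverts T \<Longrightarrow> r \<rightarrow>\<^sup>*\<^bsub>with_proj T\<^esub> v"
    by (auto simp: strongly_connected_def)
  then have "graph_dist T r v \<le> ereal (real (card (pverts T)))" if v: "v \<in> pverts T" for v
  proof -
    obtain p where p: "apath r p v"
      using \<open>\<And>v. v \<in> pverts T \<Longrightarrow> r \<rightarrow>\<^sup>*\<^bsub>with_proj T\<^esub> v\<close>[OF v] unfolding reachable_apath by blast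
    have "ereal (real (length p)) \<le> ereal (real (card (pverts T)))"
      using length_apath[OF p] by simp
    with graph_dist_le_length[OF awalkI_apath[OF p]] show ?thesis by (rule order.trans)
  qed
  then show "\<exists>h. \<exists>r\<in>pverts T. \<forall>v\<in>pverts T. graph_dist T r v \<le> ereal (real h)"
    using r by blast
qed

text \<open>Supplies the assumption \<open>2 \<le> m\<close> of \<open>degree_bound\<close>: a tree
  with one vertex has radius 0.\<close>

lemma card_gt_1_if_radius_pos:
  assumes T: "graph_tree T" and pos: "0 < graph_radius T"
  shows "2 \<le> card (pverts T)"
proof (rule ccontr)
  assume small: "\<not> ?thesis"
  interpret pair_graph T using T by (simp add: graph_tree_def)
  obtain r where r: "r \<in> pverts T" using tree_centre[OF T] by blast
  have "card (pverts T) \<le> Suc 0" using small by simp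
  then have "v = r" if "v \<in> pverts T" for v
    using that r pair_finite_verts by (simp add: card_le_Suc0_iff_eq)
  moreover have "graph_dist T r r \<le> ereal (real 0)"
    using graph_dist_le_length[of r "[]" r] r by (simp add: awalk_Nil_iff)
  ultimately have "\<forall>v\<in>pverts T. graph_dist T r v \<le> ereal (real 0)" by metis
  then have "graph_radius T \<le> 0"
    unfolding graph_radius_def using r by (intro Least_le) blast
  with pos show False by simp
qed

section \<open>Induced copies, the numerical bound and the conclusion\<close>

lemma induced_copy:
  fixes T :: "'b pair_pre_digraph" and \<Gamma> G :: "'a pair_pre_digraph"
  assumes T: "pair_graph T" and \<Gamma>: "pair_graph \<Gamma>"
    and sub: "subgraph (with_proj G) (with_proj \<Gamma>)"
    and inj: "inj_on f (pverts T)" and img: "f ` pverts T \<subseteq> pverts G"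
    and edge: "\<And>x y. x \<in> pverts T \<Longrightarrow> y \<in> pverts T \<Longrightarrow> (x, y) \<in> parcs T \<Longrightarrow> (f x, f y) \<in> parcs G"
    and nonedge: "\<And>x y. x \<in> pverts T \<Longrightarrow> y \<in> pverts T \<Longrightarrow> (f x, f y) \<in> parcs \<Gamma> \<Longrightarrow> (x, y) \<in> parcs T"
  shows "\<exists>H :: 'a pair_pre_digraph.
       subgraph (with_proj H) (with_proj G) \<and>
       induced_subgraph (with_proj H) (with_proj \<Gamma>) \<and>
       digraph_iso (with_proj H) (with_proj T)"
proof -
  interpret T: pair_graph T by (rule T)
  interpret \<Gamma>: pair_graph \<Gamma> by (rule \<Gamma>)
  have wfG: "wf_digraph (with_proj G)" and GV: "pverts G \<subseteq> pverts \<Gamma>" and GE: "parcs G \<subseteq> parcs \<Gamma>"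
    using sub by (auto simp: subgraph_def)
  define H where "H = \<lparr>pverts = f ` pverts T, parcs = map_prod f f ` parcs T\<rparr>"
  have Hs: "pverts H = f ` pverts T" "parcs H = map_prod f f ` parcs T" by (simp_all add: H_def)
  have wfH: "wf_digraph (with_proj H)"
    by unfold_locales (auto simp: Hs dest: T.in_arcsD1 T.in_arcsD2)
  have compat: "compatible (with_proj K) (with_proj H)" for K :: "'a pair_pre_digraph"
    by (simp add: compatible_def)
  have HG: "parcs H \<subseteq> parcs G"
    using edge by (auto simp: Hs dest: T.in_arcsD1 T.in_arcsD2)
  have 1: "subgraph (with_proj H) (with_proj G)"
    using wfG wfH compat HG img by (simp add: subgraph_def Hs)
  have "subgraph (with_proj H) (with_proj \<Gamma>)"
    using \<Gamma>.wf_digraph_axioms wfH compat HG img GV GE by (auto simp add: subgraph_def Hs)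
  moreover have "parcs H = {e \<in> parcs \<Gamma>. fst e \<in> pverts H \<and> snd e \<in> pverts H}"
  proof (intro equalityI subsetI)
    fix e assume "e \<in> parcs H"
    then show "e \<in> {e \<in> parcs \<Gamma>. fst e \<in> pverts H \<and> snd e \<in> pverts H}"
      using HG GE by (auto simp: Hs dest: T.in_arcsD1 T.in_arcsD2)
  next
    fix e assume "e \<in> {e \<in> parcs \<Gamma>. fst e \<in> pverts H \<and> snd e \<in> pverts H}"
    then obtain x y where "x \<in> pverts T" "y \<in> pverts T" "e = (f x, f y)" "(f x, f y) \<in> parcs \<Gamma>"
      by (cases e) (auto simp: Hs)
    then show "e \<in> parcs H" using nonedge[of x y] by (force simp: Hs)
  qed
  ultimately have 2: "induced_subgraph (with_proj H) (with_proj \<Gamma>)"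
    by (simp add: induced_subgraph_def)
  \<comment> \<open>The isomorphism runs from \<open>H\<close> to \<open>T\<close>, so it is built
    from the inverse of \<open>f\<close>.\<close>
  define g where "g = the_inv_into (pverts T) f"
  have g: "g (f x) = x" if "x \<in> pverts T" for x
    using that inj by (simp add: g_def the_inv_into_f_f)
  define \<phi> where "\<phi> = \<lparr>iso_verts = g, iso_arcs = map_prod g g, iso_head = snd, iso_tail = fst\<rparr>"
  have inj_g: "inj_on g (pverts H)" unfolding Hs by (intro inj_onI) (auto simp: g)
  have "inj_on (map_prod g g) (parcs H)"
  proof (rule inj_on_subset)
    show "inj_on (map_prod g g) (pverts H \<times> pverts H)" using inj_g by (rule map_prod_inj_on) (rule inj_g)
    show "parcs H \<subseteq> pverts H \<times> pverts H" by (auto simp: Hs dest: T.in_arcsD1 T.in_arcsD2)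
  qed
  then have "pre_digraph.digraph_isomorphism (with_proj H) \<phi>"
    using wfH inj_g by (simp add: pre_digraph.digraph_isomorphism_def \<phi>_def)
  moreover have "g ` pverts H = pverts T" by (simp add: Hs image_image g)
  moreover have "map_prod g g ` parcs H = parcs T"
  proof -
    have "map_prod g g (map_prod f f e) = e" if "e \<in> parcs T" for e
      using that T.in_arcsD1 T.in_arcsD2 by (cases e) (auto simp: g)
    then show ?thesis by (simp add: Hs image_image)
  qed
  ultimately have "digraph_iso (with_proj H) (with_proj T)"
    unfolding digraph_iso_def by (intro exI[of _ \<phi>]) (simp add: app_iso_def \<phi>_def with_proj_def)
  with 1 2 show ?thesis by blast
qed

lemma sparse_host_of_ct_sparse:
  fixes \<Gamma> G :: "'a pair_pre_digraph"
  assumes "0 < c" "c < 1/2" "1 \<le> t"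
    and \<Gamma>: "pair_graph \<Gamma>" and G: "pair_graph G"
    and sub: "subgraph (with_proj G) (with_proj \<Gamma>)"
    and sparse: "ct_sparse c t \<Gamma>"
  shows "sparse_host (pverts \<Gamma>) (parcs \<Gamma>) (parcs G) c t"
proof -
  interpret \<Gamma>: pair_graph \<Gamma> by (rule \<Gamma>)
  interpret G: pair_graph G by (rule G)
  show ?thesis
  proof
    show "parcs \<Gamma> \<subseteq> pverts \<Gamma> \<times> pverts \<Gamma>" by (auto dest: \<Gamma>.in_arcsD1 \<Gamma>.in_arcsD2)
    show "irrefl (parcs \<Gamma>)" using \<Gamma>.pair_no_loops by (force simp: irrefl_def)
    show "sym (parcs \<Gamma>)" "sym (parcs G)" using \<Gamma>.parcs_sym G.parcs_sym by (auto intro: symI)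
    show "parcs G \<subseteq> parcs \<Gamma>" using sub by (auto simp: subgraph_def)
  next
    fix X Y assume XY: "X \<subseteq> pverts \<Gamma>" "Y \<subseteq> pverts \<Gamma>" "t \<le> card X" "t \<le> card Y"
    then have "real (card {(u, v). u \<in> X \<and> v \<in> Y \<and> (u, v) \<in> parcs \<Gamma>})
        \<le> (1 - c) * real (card X) * real (card Y)"
      using sparse unfolding ct_sparse_def by blast
    moreover have "{(u, v). u \<in> X \<and> v \<in> Y \<and> (u, v) \<in> parcs \<Gamma>} = parcs \<Gamma> \<inter> X \<times> Y"
      by auto
    ultimately show "real (card (parcs \<Gamma> \<inter> X \<times> Y)) \<le> (1 - c) * real (card X) * real (card Y)"
      by (simp only:)
  qed (use assms \<Gamma>.pair_finite_verts in auto)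
qed

text \<open>The left side is the average degree that \<open>exists_rich\<close> asks for. With q =
  4/c \<ge> 8, both summands are at most t times q to the power 2h + 2m; one further factor q
  absorbs the sum, and 2h + 2m + 1 \<le> 4hm.\<close>

lemma degree_bound:
  fixes c :: real
  assumes "0 < c" "c < 1/2" and h: "1 \<le> h" and m: "2 \<le> m"
  shows "real t * (2/c) ^ h + (4/c) ^ h * (real m * (real t * (2/c) ^ h) * (4/c) ^ m)
    \<le> (4/c) ^ (4 * h * m) * real t"
proof -
  define q where "q = 4/c"
  have q: "8 \<le> q" using assms by (simp add: q_def field_simps)
  have p: "(2/c) ^ h \<le> q ^ h"
    unfolding q_def using assms by (intro power_mono divide_right_mono) auto
  have "real m \<le> 2 ^ m" using less_exp[of m] by (metis less_imp_le of_nat_le_iff of_nat_numeral of_nat_power)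
  also have "(2::real) ^ m \<le> q ^ m" using q by (intro power_mono) auto
  finally have mq: "real m \<le> q ^ m" .
  have "q ^ h * (real m * (real t * (2/c) ^ h) * q ^ m) \<le> q ^ h * (q ^ m * (real t * q ^ h) * q ^ m)"
    using p mq q assms(1) by (intro mult_left_mono mult_right_mono mult_mono) auto
  also have "\<dots> = real t * q ^ (2 * h + 2 * m)"
    by (simp only: power_add mult_2) (simp only: mult_ac)
  finally have A: "q ^ h * (real m * (real t * (2/c) ^ h) * q ^ m) \<le> real t * q ^ (2 * h + 2 * m)" .
  have "q ^ h \<le> q ^ (2 * h + 2 * m)" using q by (intro power_increasing) auto
  then have B: "real t * (2/c) ^ h \<le> real t * q ^ (2 * h + 2 * m)"
    using p by (intro mult_left_mono) auto
  have "2 * q ^ (2 * h + 2 * m) \<le> q * q ^ (2 * h + 2 * m)" using q by (intro mult_right_mono) auto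
  also have "\<dots> = q ^ (2 * h + 2 * m + 1)" by simp
  also have "\<dots> \<le> q ^ (4 * h * m)"
  proof (rule power_increasing)
    obtain a where "h = 1 + a" using le_Suc_ex[OF h] by blast
    moreover obtain b where "m = 2 + b" using le_Suc_ex[OF m] by blast
    ultimately show "2 * h + 2 * m + 1 \<le> 4 * h * m" by (simp add: algebra_simps)
  qed (use q in simp)
  finally have "real t * (2 * q ^ (2 * h + 2 * m)) \<le> real t * q ^ (4 * h * m)"
    by (rule mult_left_mono) simp
  with A B show ?thesis unfolding q_def[symmetric] by (simp add: mult.commute)
qed

theorem theorem1p10:
  fixes T :: "'b pair_pre_digraph"
    and \<Gamma> G :: "'a pair_pre_digraph"
    and h t :: nat
    and c :: real
  assumes "graph_tree T" and "graph_radius T = h"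
    and "0 < c" and "c < 1/2"
    and "1 \<le> t"
    and "pair_graph \<Gamma>" and "pair_graph G"
    and "subgraph (with_proj G) (with_proj \<Gamma>)"
    and "ct_sparse c t \<Gamma>"
  shows "average_degree G < (4 / c) ^ (4 * h * card (pverts T)) * real t \<or>
    (\<exists>H :: 'a pair_pre_digraph.
       subgraph (with_proj H) (with_proj G) \<and>
       induced_subgraph (with_proj H) (with_proj \<Gamma>) \<and>
       digraph_iso (with_proj H) (with_proj T))"
proof (cases "average_degree G < (4 / c) ^ (4 * h * card (pverts T)) * real t")
  case False
  interpret T: pair_graph T using assms(1) by (simp add: graph_tree_def)
  interpret G: pair_graph G by fact
  interpret sparse_host "pverts \<Gamma>" "parcs \<Gamma>" "parcs G" c t
    by (rule sparse_host_of_ct_sparse) fact+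
  define m where "m = card (pverts T)"
  \<comment> \<open>After \<open>k\<close> extensions the branching is
    \<open>m * (t * (2/c) ^ h) * (4/c) ^ (m - k)\<close>, which for \<open>k < m\<close> still
    exceeds the choices ruled out by fewer than \<open>m\<close> embedded vertices.\<close>
  define D where "D = real m * (real t * (2/c) ^ h) * (4/c) ^ m"
  have q: "1 \<le> 4/c" using assms(3,4) by (simp add: field_simps)
  have "0 < (4 / c) ^ (4 * h * m) * real t" using assms(3,5) by simp
  \<comment> \<open>The null graph has average degree 0, so positivity gives a vertex of G.\<close>
  then have deg_pos: "0 < average_degree G" using False unfolding m_def by linarith
  then have G_ne: "pverts G \<noteq> {}" by (auto simp: average_degree_def)
  obtain r where r: "r \<in> pverts T"
    and dist: "\<And>v. v \<in> pverts T \<Longrightarrow> graph_dist T r v \<le> ereal (real h)"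
    using tree_centre[OF assms(1)] unfolding assms(2) by blast
  have m_pos: "0 < m" using r T.pair_finite_verts by (auto simp: m_def card_gt_0_iff)
  have t_h: "1 \<le> real t * (2/c) ^ h" using t_le_pow[of h] assms(5) by linarith
  have shrink: "(c/4) ^ k * D = real m * (real t * (2/c) ^ h) * (4/c) ^ (m - k)" if "k \<le> m" for k
  proof -
    have "(c/4) ^ k * (4/c) ^ k = 1" using assms(3) by (simp flip: power_mult_distrib)
    moreover have "(4/c) ^ m = (4/c) ^ k * (4/c) ^ (m - k)" using that by (simp flip: power_add)
    ultimately have "(c/4) ^ k * (4/c) ^ m = (4/c) ^ (m - k)" by (simp flip: mult.assoc)
    then show ?thesis by (simp add: D_def)
  qed
  have big: "real m * (real t * (2/c) ^ h) * (4/c) \<le> (c/4) ^ k * D" if "k < m" for k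
  proof -
    have "(4/c) ^ 1 \<le> (4/c) ^ (m - k)" using that q by (intro power_increasing) auto
    then show ?thesis unfolding shrink[OF less_imp_le[OF that]]
      using t_h by (intro mult_left_mono) auto
  qed
  have mt: "1 \<le> real m * (real t * (2/c) ^ h)"
    using m_pos t_h mult_mono[of 1 "real m" 1 "real t * (2/c) ^ h"] by simp
  have big_q: "4/c \<le> (c/4) ^ k * D" if "k < m" for k
    using big[OF that] mult_right_mono[OF mt, of "4/c"] q by linarith
  have big_t: "real m * (real t * (2/c) ^ h) \<le> (c/4) ^ k * D" if "k < m" for k
    using big[OF that] mult_left_mono[OF q, of "real m * (real t * (2/c) ^ h)"] mt by linarith
  have arcs_G: "parcs G \<subseteq> pverts G \<times> pverts G" by (auto dest: G.in_arcsD1 G.in_arcsD2)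
  have "\<exists>w\<in>pverts G. rich D {} h w"
  proof (cases "h = 0")
    \<comment> \<open>For radius 0 every vertex is rich; \<open>degree_bound\<close> covers only
      \<open>1 \<le> h\<close>.\<close>
    case True
    then show ?thesis using G_ne by auto
  next
    case h: False
    have m2: "2 \<le> m"
      unfolding m_def using h assms(1,2) by (intro card_gt_1_if_radius_pos) auto
    \<comment> \<open>\<open>exists_rich\<close> is applied with \<open>(4/c) ^ h * D\<close>, so
      that branching \<open>D\<close> remains after its loss of \<open>(c/4) ^ h\<close>.\<close>
    have D: "(c/4) ^ h * ((4/c) ^ h * D) = D"
      using assms(3) by (simp flip: mult.assoc power_mult_distrib)
    have "1 * (real t * (2/c) ^ h) \<le> real m * (real t * (2/c) ^ h)"
      using m_pos t_h by (intro mult_right_mono) auto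
    then have tD: "real t \<le> D" using t_le_pow[of h] big_t[OF m_pos] by simp
    have qD: "4/c \<le> D" using big_q[OF m_pos] by simp
    have "real t * (2/c) ^ h + (4/c) ^ h * D \<le> average_degree G"
      using degree_bound[of c h m t] h m2 assms(3,4) False unfolding D_def m_def[symmetric] by simp
    then have "real (card (pverts G)) * (real t * (2/c) ^ h + (4/c) ^ h * D)
        \<le> real (card (pverts G)) * average_degree G"
      by (rule mult_left_mono) simp
    also have "\<dots> = real (card (parcs G))"
      using G_ne G.pair_finite_verts by (simp add: G.average_degree_conv)
    finally have dense: "real (card (pverts G)) * (real t * (2/c) ^ h + (4/c) ^ h * D)
        \<le> real (card (parcs G))" .
    have "pverts G \<subseteq> pverts \<Gamma>" using assms(8) by (auto simp: subgraph_def)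
    then show ?thesis
      using exists_rich[OF G.pair_finite_verts G_ne arcs_G _ _ _ dense, unfolded D] tD qD by blast
  qed
  then obtain w where w: "w \<in> pverts G" "rich D {} h w" by blast
  have few: "real (Suc k) * (real t * (2/c) ^ h) < (c/4) ^ k * D" if "Suc k < card (pverts T)" for k
  proof -
    have k: "Suc k < m" using that by (simp add: m_def)
    then have "real (Suc k) * (real t * (2/c) ^ h) < real m * (real t * (2/c) ^ h)"
      using t_h by (intro mult_strict_right_mono) auto
    also have "\<dots> \<le> (c/4) ^ k * D" using k by (intro big_t) simp
    finally show ?thesis .
  qed
  have large: "4 / c \<le> (c/4) ^ k * D" if "Suc k < card (pverts T)" for k
    using that by (intro big_q) (simp add: m_def)
  have reach: "\<exists>n\<le>h. (r, v) \<in> parcs T ^^ n" if "v \<in> pverts T" for v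
    using T.graph_dist_le_imp_relpow[OF dist[OF that]] .
  obtain f where "inj_on f (pverts T)" "f ` pverts T \<subseteq> pverts G"
    "\<forall>x\<in>pverts T. \<forall>y\<in>pverts T. ((x, y) \<in> parcs T \<longrightarrow> (f x, f y) \<in> parcs G) \<and>
      ((f x, f y) \<in> parcs \<Gamma> \<longrightarrow> (x, y) \<in> parcs T)"
    using tree_embeds[OF assms(1) r reach arcs_G w few large] by blast
  then show ?thesis
    using induced_copy[OF T.pair_graph assms(6,8), of f] by blast
qed blast

end
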